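(* Let $P=(p_1,\dots,p_n)$ be a closed $n$-gon in $\mathbb{P}^1$ with discrete curvature $\alpha=(\alpha_1,\dots,\alpha_n)$, $\alpha_i\in\mathbb{G}_m\setminus\{1\}$. The infinitesimal monodromy for the flat cross-ratio dynamics (with respect to the scaling symmetry $\alpha_i(t)=1+\kappa_i(t\alpha_1-1)$, $c_i(t)=c_i\,\alpha_i(t)/\alpha_i$, $\kappa_i=\frac{\alpha_i-1}{\alpha_1-1}$) is $$M'(1)=\sum_{i=1}^n \frac{(\alpha_i-1)\alpha_1}{(\alpha_1-1)\alpha_i}\,\frac{1}{p_i-p_{i+1}}\begin{pmatrix} p_i & -p_ip_{i+1}\\ 1 & -p_{i+1}\end{pmatrix}$$ (as an element of $\mathfrak{pgl}_2$), and its eigenvectors $(X,Y)^T$ are roots of the polynomial $$\chi_P(X,Y)=\sum_{i=1}^n \frac{\alpha_i-1}{\alpha_i}\,\frac{(X-p_iY)(X-p_{i+1}Y)}{p_i-p_{i+1}}.$$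
   Context: Let $F$ be a field, $\mathbb{P}^1=\mathbb{P}^1(F)$, $\mathrm{PGL}_2=\mathrm{GL}_2(F)/F^*$, $\mathbb{G}_m=F^*$ (as algebraic group), $n\geq3$. For four points of $\mathbb{P}^1$, $[a,b,c,d]=\frac{a-c}{a-d}\cdot\frac{b-d}{b-c}$. A (twisted) $n$-gon in $\mathbb{P}^1$ is $P=((p_i)_{i\in\mathbb{Z}},M)$ with monodromy $M\in\mathrm{PGL}_2$, $p_{i+n}=Mp_i$, with $p_i,p_{i+1},p_{i+2}$ pairwise distinct for all $i$; it is closed if $M=\mathrm{Id}$. Points are identified with affine coordinates in $F$. $\mathrm{PGL}_2$ acts by $A\cdot P=((Ap_i),AMA^{-1})$, with quotient the moduli space. The cross-ratio coordinates $c_i=[p_i,p_{i+1},p_{i-1},p_{i+2}]$ ($n$-periodic) determine the class $[P]$. Flat cross-ratio dynamics: $n$-gons carry an $n$-periodic discrete curvature $\alpha=(\alpha_i)$, $\alpha_i\in\mathbb{G}_m\setminus\{1\}$. $P,Q$ are $\alpha$-related if they have the same monodromy, the same discrete curvature, and $[p_i,p_{i+1},q_i,q_{i+1}]=\alpha_i$ for all $i$; generically exactly two $n$-gons $Q^+,Q^-$ are $\alpha$-related to $P$, giving the evolution operator (future/past). The displayed action of $\mathbb{G}_m$ on $(c,\alpha)$ is a scaling symmetry, i.e. a non-trivial (partially defined) $\mathbb{G}_m$-action commuting with the dynamic; write $[P]_t$ for the class with coordinates $c_i(t)$. A lift of the deformation is an algebraic family $(P_t)$ of $n$-gons with $P_1=P$,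 $[P_t]=[P]_t$; $M(t)$ denotes the monodromy of $P_t$. For $P$ closed, the infinitesimal monodromy is $M'(1)\in\mathfrak{pgl}_2=\mathfrak{gl}_2/F\cdot\mathrm{Id}$ (the tangent vector at $M(1)=\mathrm{Id}$), independent of the lift. *)

theory Defs
  imports
    "HOL-Analysis.Analysis"
    "HOL-Computational_Algebra.Polynomial_Factorial"
begin

section \<open>The projective line, \<open>PGL\<^sub>2\<close> and its Lie algebra over a field\<close>

definition proportional :: "'a::field ^ 2 \<Rightarrow> 'a ^ 2 \<Rightarrow> bool" where
  "proportional v w \<longleftrightarrow> v \<noteq> 0 \<and> w \<noteq> 0 \<and> (\<exists>c. c \<noteq> 0 \<and> w = c *s v)"

quotient_type (overloaded) 'a pline = "'a::field ^ 2" / partial: proportional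
proof (rule part_equivpI)
  show "\<exists>v::'a ^ 2. proportional v v"
    by (rule exI[of _ "1"], auto simp: proportional_def vec_eq_iff intro!: exI[of _ 1])
  show "symp (proportional :: 'a ^ 2 \<Rightarrow> _)"
  proof (rule sympI)
    fix v w :: "'a ^ 2" assume "proportional v w"
    then obtain c where "v \<noteq> 0" "w \<noteq> 0" "c \<noteq> 0" "w = c *s v"
      by (auto simp: proportional_def)
    then show "proportional w v"
      by (auto simp: proportional_def vector_smult_assoc intro!: exI[of _ "inverse c"])
  qed
  show "transp (proportional :: 'a ^ 2 \<Rightarrow> _)"
  proof (rule transpI)
    fix u v w :: "'a ^ 2" assume "proportional u v" "proportional v w"
    then obtain c d where "u \<noteq> 0" "v \<noteq> 0" "w \<noteq> 0" "c \<noteq> 0" "v = c *s u" "d \<noteq> 0" "w = d *s v"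
      by (auto simp: proportional_def)
    then show "proportional u w"
      by (auto simp: proportional_def vector_smult_assoc intro!: exI[of _ "d * c"])
  qed
qed

text \<open>\<open>abs_pline v\<close> is the point with homogeneous coordinates \<open>v\<close>; it is meaningful only
  for \<open>v \<noteq> 0\<close>.\<close>

lift_definition affine_point :: "'a::field \<Rightarrow> 'a pline" is "\<lambda>x. vector [x, 1]"
  by (auto simp: proportional_def vec_eq_iff forall_2 intro!: exI[of _ 1])

definition scalar_multiple :: "'a::field ^ 2 ^ 2 \<Rightarrow> 'a ^ 2 ^ 2 \<Rightarrow> bool" where
  "scalar_multiple A B \<longleftrightarrow>
     invertible A \<and> invertible B \<and> (\<exists>c. c \<noteq> 0 \<and> B = map_matrix ((*) c) A)"

quotient_type (overloaded) 'a pgl2 = "'a::field ^ 2 ^ 2" / partial: scalar_multiple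
proof (rule part_equivpI)
  show "\<exists>A::'a ^ 2 ^ 2. scalar_multiple A A"
    by (rule exI[of _ "mat 1"])
      (auto simp: scalar_multiple_def vec_eq_iff invertible_det_nz intro!: exI[of _ 1])
  show "symp (scalar_multiple :: 'a ^ 2 ^ 2 \<Rightarrow> _)"
  proof (rule sympI)
    fix A B :: "'a ^ 2 ^ 2" assume "scalar_multiple A B"
    then obtain c where "invertible A" "invertible B" "c \<noteq> 0" "B = map_matrix ((*) c) A"
      by (auto simp: scalar_multiple_def)
    moreover from this have "A = map_matrix ((*) (inverse c)) B" by (simp add: vec_eq_iff)
    ultimately show "scalar_multiple B A"
      unfolding scalar_multiple_def using nonzero_imp_inverse_nonzero by blast
  qed
  show "transp (scalar_multiple :: 'a ^ 2 ^ 2 \<Rightarrow> _)"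
  proof (rule transpI)
    fix A B C :: "'a ^ 2 ^ 2" assume "scalar_multiple A B" "scalar_multiple B C"
    then obtain c d where "invertible A" "invertible C" "c \<noteq> 0" "B = map_matrix ((*) c) A"
      "d \<noteq> 0" "C = map_matrix ((*) d) B"
      by (auto simp: scalar_multiple_def)
    moreover from this have "C = map_matrix ((*) (d * c)) A" by (simp add: vec_eq_iff mult.assoc)
    ultimately show "scalar_multiple A C"
      unfolding scalar_multiple_def using no_zero_divisors by blast
  qed
qed

text \<open>\<open>abs_pgl2 A\<close> is the class of \<open>A\<close>; it is meaningful only for invertible \<open>A\<close>.\<close>

lemma scalar_multiple_refl: "invertible A \<Longrightarrow> scalar_multiple A A"
  by (auto simp: scalar_multiple_def vec_eq_iff intro!: exI[of _ 1])

lift_definition pgl2_id :: "'a::field pgl2" is "mat 1"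
  by (rule scalar_multiple_refl) (simp add: invertible_det_nz)

lift_definition pgl2_act :: "'a::field pgl2 \<Rightarrow> 'a pline \<Rightarrow> 'a pline" is "\<lambda>A v. A *v v"
proof -
  fix A B :: "'a ^ 2 ^ 2" and v w :: "'a ^ 2"
  assume "scalar_multiple A B" and "proportional v w"
  then obtain c d where A: "invertible A" and B: "invertible B" and "c \<noteq> 0"
    and Beq: "B = map_matrix ((*) c) A"
    and v: "v \<noteq> 0" and w: "w \<noteq> 0" and "d \<noteq> 0" and weq: "w = d *s v"
    by (auto simp: scalar_multiple_def proportional_def)
  have nz: "C *v u \<noteq> 0" if C: "invertible C" and u: "u \<noteq> 0" for C :: "'a ^ 2 ^ 2" and u
  proof
    assume eq: "C *v u = 0"
    obtain D where "D ** C = mat 1" using C by (auto simp: invertible_def)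
    then have "u = D *v (C *v u)" by (simp add: matrix_vector_mul_assoc)
    also have "\<dots> = 0" using eq by simp
    finally show False using u by simp
  qed
  have "B *v w = (c * d) *s (A *v v)"
    by (simp add: Beq weq matrix_vector_mult_def vec_eq_iff sum_distrib_left algebra_simps)
  moreover have "c * d \<noteq> 0" using \<open>c \<noteq> 0\<close> \<open>d \<noteq> 0\<close> by simp
  ultimately show "proportional (A *v v) (B *v w)"
    unfolding proportional_def using nz[OF A v] nz[OF B w] by blast
qed

definition same_mod_scalars :: "'a::field ^ 2 ^ 2 \<Rightarrow> 'a ^ 2 ^ 2 \<Rightarrow> bool" where
  "same_mod_scalars A B \<longleftrightarrow> (\<exists>c. B = A + mat c)"

quotient_type (overloaded) 'a lie_pgl2 = "'a::field ^ 2 ^ 2" / same_mod_scalars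
proof (rule equivpI)
  show "reflp (same_mod_scalars :: 'a ^ 2 ^ 2 \<Rightarrow> _)"
    by (auto simp: reflp_def same_mod_scalars_def mat_def vec_eq_iff intro!: exI[of _ 0])
  show "symp (same_mod_scalars :: 'a ^ 2 ^ 2 \<Rightarrow> _)"
  proof (rule sympI)
    fix A B :: "'a ^ 2 ^ 2" assume "same_mod_scalars A B"
    then obtain c where "B = A + mat c" by (auto simp: same_mod_scalars_def)
    then have "A = B + mat (- c)" by (simp add: mat_def vec_eq_iff)
    then show "same_mod_scalars B A" by (auto simp: same_mod_scalars_def)
  qed
  show "transp (same_mod_scalars :: 'a ^ 2 ^ 2 \<Rightarrow> _)"
  proof (rule transpI)
    fix A B C :: "'a ^ 2 ^ 2" assume "same_mod_scalars A B" "same_mod_scalars B C"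
    then obtain c d where "B = A + mat c" "C = B + mat d" by (auto simp: same_mod_scalars_def)
    then have "C = A + mat (c + d)" by (simp add: mat_def vec_eq_iff)
    then show "same_mod_scalars A C" by (auto simp: same_mod_scalars_def)
  qed
qed

text \<open>Adding a scalar matrix shifts the eigenvalues but keeps the eigenvectors.\<close>

lift_definition is_eigenvector :: "'a::field lie_pgl2 \<Rightarrow> 'a ^ 2 \<Rightarrow> bool"
  is "\<lambda>A v. v \<noteq> 0 \<and> (\<exists>k. A *v v = k *s v)"
proof -
  fix A B :: "'a ^ 2 ^ 2"
  assume "same_mod_scalars A B"
  then obtain c where B: "B = A + mat c" by (auto simp: same_mod_scalars_def)
  have eq: "B *v v = A *v v + c *s v" for v
    by (simp add: B matrix_vector_mult_def vec_eq_iff sum_2 forall_2 mat_def algebra_simps)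
  have "(\<exists>k. A *v v = k *s v) \<longleftrightarrow> (\<exists>k. B *v v = k *s v)" for v
  proof
    assume "\<exists>k. A *v v = k *s v"
    then obtain k where "A *v v = k *s v" by blast
    then have "B *v v = (k + c) *s v" by (simp add: eq vector_sadd_rdistrib)
    then show "\<exists>k. B *v v = k *s v" by blast
  next
    assume "\<exists>k. B *v v = k *s v"
    then obtain k where "B *v v = k *s v" by blast
    then have "A *v v = (k - c) *s v"
      by (simp add: eq vec_eq_iff algebra_simps)
    then show "\<exists>k. A *v v = k *s v" by blast
  qed
  then show "(\<lambda>v. v \<noteq> 0 \<and> (\<exists>k. A *v v = k *s v)) = (\<lambda>v. v \<noteq> 0 \<and> (\<exists>k. B *v v = k *s v))"
    by (intro ext) auto
qed

section \<open>Cross-ratios and polygons\<close>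

definition bracket :: "'a::field ^ 2 \<Rightarrow> 'a ^ 2 \<Rightarrow> 'a" where
  "bracket v w = v $ 1 * w $ 2 - w $ 1 * v $ 2"

text \<open>The homogeneous form of \<open>(a - c) / (a - d) * ((b - d) / (b - c))\<close>, defined also when one
  of the points is at infinity.  The value is junk (zero) if \<open>a = d\<close> or \<open>b = c\<close>.\<close>

lift_definition cross_ratio :: "'a::field pline \<Rightarrow> 'a pline \<Rightarrow> 'a pline \<Rightarrow> 'a pline \<Rightarrow> 'a"
  is "\<lambda>a b c d. bracket a c / bracket a d * (bracket b d / bracket b c)"
  by (auto simp: proportional_def bracket_def mult.left_commute mult.assoc
      simp flip: right_diff_distrib)

lemma cross_ratio_affine:
  "cross_ratio (affine_point a) (affine_point b) (affine_point c) (affine_point d) =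
     (a - c) / (a - d) * ((b - d) / (b - c))"
  by transfer (simp add: bracket_def)

definition twisted_ngon :: "nat \<Rightarrow> (int \<Rightarrow> 'a::field pline) \<Rightarrow> 'a pgl2 \<Rightarrow> bool" where
  "twisted_ngon n p M \<longleftrightarrow>
     (\<forall>i. p (i + int n) = pgl2_act M (p i)) \<and>
     (\<forall>i. p i \<noteq> p (i + 1) \<and> p i \<noteq> p (i + 2) \<and> p (i + 1) \<noteq> p (i + 2))"

definition closed_ngon :: "nat \<Rightarrow> (int \<Rightarrow> 'a::field pline) \<Rightarrow> bool" where
  "closed_ngon n p \<longleftrightarrow> twisted_ngon n p pgl2_id"

definition cross_ratio_coord :: "(int \<Rightarrow> 'a::field pline) \<Rightarrow> int \<Rightarrow> 'a" where
  "cross_ratio_coord p i = cross_ratio (p i) (p (i + 1)) (p (i - 1)) (p (i + 2))"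

definition discrete_curvature :: "nat \<Rightarrow> (int \<Rightarrow> 'a::field) \<Rightarrow> bool" where
  "discrete_curvature n \<alpha> \<longleftrightarrow> (\<forall>i. \<alpha> (i + int n) = \<alpha> i \<and> \<alpha> i \<noteq> 0 \<and> \<alpha> i \<noteq> 1)"

section \<open>Algebraic families in a parameter \<open>t\<close> near \<open>t = 1\<close>\<close>

text \<open>An algebraic family over a Zariski neighbourhood of \<open>t = 1\<close> is an object over the function
  field \<open>F(t)\<close>, here \<^typ>\<open>'a poly fract\<close>, that is regular at \<open>t = 1\<close>.  This makes sense over every
  field, including finite ones, where there may be no values of \<open>t\<close> other than \<open>1\<close> to
  substitute.  After clearing denominators, a point regular at \<open>t = 1\<close> has polynomial homogeneous
  coordinates that do not all vanish at \<open>t = 1\<close>, and an element of \<open>PGL\<^sub>2\<close> regular at \<open>t = 1\<close> has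
  a polynomial matrix whose value at \<open>t = 1\<close> is invertible.\<close>

definition parameter :: "'a::field poly fract" where
  "parameter = to_fract [:0, 1:]"

definition const_fract :: "'a::field \<Rightarrow> 'a poly fract" where
  "const_fract a = to_fract [:a:]"

definition point_at_1 :: "'a::field poly fract pline \<Rightarrow> 'a pline \<Rightarrow> bool" where
  "point_at_1 q p \<longleftrightarrow>
     (\<exists>x y :: 'a poly. (poly x 1 \<noteq> 0 \<or> poly y 1 \<noteq> 0) \<and>
        q = abs_pline (vector [to_fract x, to_fract y]) \<and>
        p = abs_pline (vector [poly x 1, poly y 1]))"

definition pgl2_at_1 :: "'a::field poly fract pgl2 \<Rightarrow> 'a pgl2 \<Rightarrow> bool" where
  "pgl2_at_1 M N \<longleftrightarrow>
     (\<exists>A :: 'a poly ^ 2 ^ 2. invertible (map_matrix (\<lambda>f. poly f 1) A) \<and>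
        M = abs_pgl2 (map_matrix to_fract A) \<and>
        N = abs_pgl2 (map_matrix (\<lambda>f. poly f 1) A))"

text \<open>\<open>velocity_at_1 M \<xi>\<close> says that \<open>M(1) = Id\<close> and \<open>M'(1) = \<xi>\<close>.  A polynomial matrix representing
  \<open>M\<close> is a scalar matrix at \<open>t = 1\<close> and can be rescaled by a constant to be the identity there;
  another such choice changes the derivative by a multiple of the identity.\<close>

definition velocity_at_1 :: "'a::field poly fract pgl2 \<Rightarrow> 'a lie_pgl2 \<Rightarrow> bool" where
  "velocity_at_1 M \<xi> \<longleftrightarrow>
     (\<exists>A :: 'a poly ^ 2 ^ 2. map_matrix (\<lambda>f. poly f 1) A = mat 1 \<and>
        M = abs_pgl2 (map_matrix to_fract A) \<and>
        \<xi> = abs_lie_pgl2 (map_matrix (\<lambda>f. poly (pderiv f) 1) A))"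

text \<open>A deformation of the class of \<open>p\<close> in the moduli space is given by its cross-ratio
  coordinates \<open>c i\<close> as functions of \<open>t\<close>.\<close>

definition lift_of_deformation ::
  "nat \<Rightarrow> (int \<Rightarrow> 'a::field pline) \<Rightarrow> 'a pgl2 \<Rightarrow> (int \<Rightarrow> 'a poly fract) \<Rightarrow>
   (int \<Rightarrow> 'a poly fract pline) \<Rightarrow> 'a poly fract pgl2 \<Rightarrow> bool" where
  "lift_of_deformation n p N c q M \<longleftrightarrow>
     twisted_ngon n q M \<and>
     (\<forall>i. point_at_1 (q i) (p i)) \<and> pgl2_at_1 M N \<and>
     (\<forall>i. cross_ratio_coord q i = c i)"

definition is_infinitesimal_monodromy ::
  "nat \<Rightarrow> (int \<Rightarrow> 'a::field pline) \<Rightarrow> (int \<Rightarrow> 'a poly fract) \<Rightarrow> 'a lie_pgl2 \<Rightarrow> bool" where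
  "is_infinitesimal_monodromy n p c \<xi> \<longleftrightarrow>
     (\<exists>q M. lift_of_deformation n p pgl2_id c q M) \<and>
     (\<forall>q M. lift_of_deformation n p pgl2_id c q M \<longrightarrow> (\<forall>\<eta>. velocity_at_1 M \<eta> \<longleftrightarrow> \<eta> = \<xi>))"

section \<open>The scaling symmetry of flat cross-ratio dynamics\<close>

definition scaling_weight :: "(int \<Rightarrow> 'a::field) \<Rightarrow> int \<Rightarrow> 'a" where
  "scaling_weight \<alpha> i = (\<alpha> i - 1) / (\<alpha> 1 - 1)"

definition scaled_curvature :: "(int \<Rightarrow> 'a::field) \<Rightarrow> int \<Rightarrow> 'a poly fract" where
  "scaled_curvature \<alpha> i =
     1 + const_fract (scaling_weight \<alpha> i) * (parameter * const_fract (\<alpha> 1) - 1)"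

definition scaled_coord :: "(int \<Rightarrow> 'a::field pline) \<Rightarrow> (int \<Rightarrow> 'a) \<Rightarrow> int \<Rightarrow> 'a poly fract" where
  "scaled_coord p \<alpha> i =
     const_fract (cross_ratio_coord p i) * scaled_curvature \<alpha> i / const_fract (\<alpha> i)"

definition edge_matrix :: "'a::field \<Rightarrow> 'a \<Rightarrow> 'a ^ 2 ^ 2" where
  "edge_matrix a b =
     map_matrix ((*) (1 / (a - b))) (vector [vector [a, - (a * b)], vector [1, - b]])"

definition chi :: "nat \<Rightarrow> (int \<Rightarrow> 'a::field) \<Rightarrow> (int \<Rightarrow> 'a) \<Rightarrow> 'a \<Rightarrow> 'a \<Rightarrow> 'a" where
  "chi n x \<alpha> X Y =
     (\<Sum>i = 1..int n. (\<alpha> i - 1) / \<alpha> i *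
        ((X - x i * Y) * (X - x (i + 1) * Y) / (x i - x (i + 1))))"

end

theory Submission
  imports Defs
begin

text \<open>Multiplying the cross-ratio coordinate \<open>c i\<close> by \<open>1 + s\<close>, while the vertices \<open>i - 1\<close>, \<open>i\<close>, \<open>i + 1\<close> stay
  put, moves the vertex \<open>i + 2\<close> by the dilation \<open>1 + s E\<close>, where \<open>E\<close> is the edge matrix of the
  vertices \<open>i\<close> and \<open>i + 1\<close>: it fixes both ends of the edge (\<open>cross_ratio_dilation\<close>).  A polygon whose
  coordinates are \<open>(1 + s i)\<close> times those of \<open>p\<close> can therefore be developed from \<open>p\<close> with frames
  \<open>H i\<close> that satisfy \<open>H 1 = 1\<close> and \<open>H (i + 1) = H i (1 + s i E i)\<close>, its \<open>i\<close>-th vertex being \<open>H i (p i)\<close>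
  (locale \<open>developed_polygon\<close>).  As \<open>p\<close> is closed, the monodromy of this polygon is the product
  \<open>(1 + s 1 E 1) ... (1 + s n E n)\<close>.

  Under the scaling symmetry \<open>s i = w i (t - 1)\<close>, where
  \<open>w i = (\<alpha> i - 1) \<alpha> 1 / ((\<alpha> 1 - 1) \<alpha> i)\<close> is the logarithmic derivative of \<open>c i\<close> (\<open>scaled_coord_eq\<close>).  The product
  is the identity at \<open>t = 1\<close> and its derivative there is the sum of the \<open>w i E i\<close>, as claimed.

  The same holds for every lift, because polygons with equal cross-ratio coordinates differ by a
  projective transformation \<open>G\<close>.  The transformation can be read off from three vertices, and as
  these have the limits \<open>p 0\<close>, \<open>p 1\<close>, \<open>p 2\<close> in both polygons, it is regular and equal to the identity
  at \<open>t = 1\<close> (\<open>exists_frame_at_1\<close>).  Conjugation by \<open>G\<close> does not change the velocity of a curve through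
  the identity: velocities add under products and change sign under inverses.

  Finally, \<open>v\<close> is an eigenvector of a matrix \<open>A\<close> iff \<open>v\<close> and \<open>A v\<close> are linearly dependent.  The determinant
  of these two vectors is linear in \<open>A\<close>, and for the sum of the \<open>w i E i\<close> it is a nonzero multiple of
  the polynomial \<open>chi\<close>.\<close>

section \<open>Points and transformations of the projective line\<close>

lemmas matrix2_simps =
  vec_eq_iff forall_2 sum_2 matrix_matrix_mult_def matrix_vector_mult_def mat_def

lemma proportional_iff_bracket:
  fixes v w :: "'a::field ^ 2"
  assumes "v \<noteq> 0" and "w \<noteq> 0"
  shows "proportional v w \<longleftrightarrow> bracket v w = 0"
proof
  assume "proportional v w"
  then show "bracket v w = 0"
    by (auto simp: proportional_def bracket_def)
next
  assume 0: "bracket v w = 0"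
  show "proportional v w"
  proof (cases "v $ 1 = 0")
    case True
    then have v2: "v $ 2 \<noteq> 0" using assms by (auto simp: vec_eq_iff forall_2)
    then have "w $ 1 = 0" using 0 True by (auto simp: bracket_def)
    then have "w = (w $ 2 / v $ 2) *s v" "w $ 2 \<noteq> 0"
      using True v2 assms by (auto simp: vec_eq_iff forall_2)
    then show ?thesis using assms v2 unfolding proportional_def
      by (metis divide_eq_0_iff)
  next
    case False
    then have w1: "w $ 1 \<noteq> 0" using 0 assms by (auto simp: bracket_def vec_eq_iff forall_2)
    have "w = (w $ 1 / v $ 1) *s v"
      using False 0 by (auto simp: vec_eq_iff forall_2 bracket_def field_simps)
    then show ?thesis using assms False w1 unfolding proportional_def
      by (metis divide_eq_0_iff)
  qed
qed

lemma proportional_self_iff: "proportional v v \<longleftrightarrow> v \<noteq> 0"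
  by (auto simp: proportional_def intro!: exI[of _ 1])

lemma abs_pline_eq_iff:
  fixes v w :: "'a::field ^ 2"
  assumes "v \<noteq> 0" and "w \<noteq> 0"
  shows "abs_pline v = abs_pline w \<longleftrightarrow> bracket v w = 0"
proof -
  have "abs_pline v = abs_pline w \<longleftrightarrow> proportional v w"
    using Quotient3_rel[OF Quotient3_pline, of v w] assms by (simp add: proportional_self_iff)
  then show ?thesis using proportional_iff_bracket assms by blast
qed

lemma abs_pline_smult:
  fixes v :: "'a::field ^ 2"
  assumes "v \<noteq> 0" and "c \<noteq> 0"
  shows "abs_pline (c *s v) = abs_pline v"
proof -
  have "c *s v \<noteq> 0" using assms by auto
  then show ?thesis by (simp add: abs_pline_eq_iff assms bracket_def)
qed

lemma pline_cases:
  obtains v :: "'a::field ^ 2" where "v \<noteq> 0" and "p = abs_pline v"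
  by (induction p rule: pline.abs_induct) (auto simp: proportional_def)

lemma vector_1_nonzero: "vector [a, 1] \<noteq> (0 :: 'a::field ^ 2)"
  by (simp add: vec_eq_iff forall_2)

lemma affine_point_eq_iff: "affine_point a = affine_point b \<longleftrightarrow> a = b"
  by (simp add: affine_point.abs_eq abs_pline_eq_iff vector_1_nonzero bracket_def)

lemma scalar_multiple_self_iff: "scalar_multiple A A \<longleftrightarrow> invertible A"
  by (metis scalar_multiple_def scalar_multiple_refl)

lemma pgl2_cases:
  obtains A :: "'a::field ^ 2 ^ 2" where "invertible A" and "M = abs_pgl2 A"
  by (induction M rule: pgl2.abs_induct) (auto simp: scalar_multiple_def)

lemma abs_pgl2_eq_iff:
  fixes A B :: "'a::field ^ 2 ^ 2"
  assumes "invertible A" and "invertible B"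
  shows "abs_pgl2 A = abs_pgl2 B \<longleftrightarrow> (\<exists>c. c \<noteq> 0 \<and> B = map_matrix ((*) c) A)"
  using Quotient3_rel[OF Quotient3_pgl2, of A B] assms
  by (auto simp: scalar_multiple_self_iff) (auto simp: scalar_multiple_def)

lemma invertible_mult_nonzero:
  fixes A :: "'a::field ^ 2 ^ 2"
  assumes "invertible A" and "v \<noteq> 0"
  shows "A *v v \<noteq> 0"
proof
  assume "A *v v = 0"
  obtain B where "B ** A = mat 1" using assms by (auto simp: invertible_def)
  then have "v = B *v (A *v v)" by (simp add: matrix_vector_mul_assoc)
  also have "\<dots> = 0" using \<open>A *v v = 0\<close> by simp
  finally show False using assms by simp
qed

lemma pgl2_act_abs:
  fixes A :: "'a::field ^ 2 ^ 2"
  assumes "invertible A" and "v \<noteq> 0"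
  shows "pgl2_act (abs_pgl2 A) (abs_pline v) = abs_pline (A *v v)"
  using assms by (simp add: pgl2_act.abs_eq scalar_multiple_self_iff proportional_self_iff)

lemma pgl2_act_mult:
  fixes A B :: "'a::field ^ 2 ^ 2"
  assumes "invertible A" and "invertible B"
  shows "pgl2_act (abs_pgl2 (A ** B)) p = pgl2_act (abs_pgl2 A) (pgl2_act (abs_pgl2 B) p)"
proof -
  obtain v where "v \<noteq> 0" and "p = abs_pline v" by (rule pline_cases)
  then show ?thesis
    using assms by (simp add: pgl2_act_abs invertible_mult invertible_mult_nonzero
        matrix_vector_mul_assoc)
qed

lemma pgl2_act_id: "pgl2_act pgl2_id p = (p :: 'a::field pline)"
  by (rule pline_cases[of p])
    (simp add: pgl2_id.abs_eq pgl2_act_abs invertible_det_nz)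

lemma bracket_mult: "bracket (A *v v) (A *v w) = det A * bracket v w"
  by (simp add: bracket_def matrix2_simps det_2 algebra_simps)

lemma pgl2_act_inject:
  fixes A :: "'a::field ^ 2 ^ 2"
  assumes "invertible A"
  shows "pgl2_act (abs_pgl2 A) p = pgl2_act (abs_pgl2 A) q \<longleftrightarrow> p = q"
proof -
  obtain v w where "v \<noteq> 0" "p = abs_pline v" "w \<noteq> 0" "q = abs_pline w"
    by (metis pline_cases)
  then show ?thesis using assms
    by (simp add: pgl2_act_abs abs_pline_eq_iff invertible_mult_nonzero bracket_mult
        invertible_det_nz)
qed

lemma cross_ratio_abs:
  fixes a b c d :: "'a::field ^ 2"
  assumes "a \<noteq> 0" "b \<noteq> 0" "c \<noteq> 0" "d \<noteq> 0"
  shows "cross_ratio (abs_pline a) (abs_pline b) (abs_pline c) (abs_pline d) =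
    bracket a c / bracket a d * (bracket b d / bracket b c)"
  using assms by (simp add: cross_ratio.abs_eq proportional_self_iff)

lemma cross_ratio_act:
  fixes A :: "'a::field ^ 2 ^ 2"
  assumes "invertible A"
  shows "cross_ratio (pgl2_act (abs_pgl2 A) a) (pgl2_act (abs_pgl2 A) b)
      (pgl2_act (abs_pgl2 A) c) (pgl2_act (abs_pgl2 A) d) = cross_ratio a b c d"
proof -
  obtain a' where a: "a' \<noteq> 0" "a = abs_pline a'" by (rule pline_cases)
  obtain b' where b: "b' \<noteq> 0" "b = abs_pline b'" by (rule pline_cases)
  obtain c' where c: "c' \<noteq> 0" "c = abs_pline c'" by (rule pline_cases)
  obtain d' where d: "d' \<noteq> 0" "d = abs_pline d'" by (rule pline_cases)
  have "det A \<noteq> 0" using assms by (simp add: invertible_det_nz)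
  with a b c d show ?thesis using assms
    by (simp add: pgl2_act_abs cross_ratio_abs invertible_mult_nonzero bracket_mult)
qed

text \<open>The cross-ratio is a coordinate on the line once three of the points are fixed: equality of the
  two values, with denominators cleared, is the vanishing of a product of brackets.\<close>

lemma cross_ratio_determines_last:
  fixes a b c d d' :: "'a::field pline"
  assumes "a \<noteq> b" "a \<noteq> c" "b \<noteq> c" "a \<noteq> d" "a \<noteq> d'"
    and eq: "cross_ratio a b c d = cross_ratio a b c d'"
  shows "d = d'"
proof -
  obtain u where u: "u \<noteq> 0" "a = abs_pline u" by (rule pline_cases)
  obtain v where v: "v \<noteq> 0" "b = abs_pline v" by (rule pline_cases)
  obtain w where w: "w \<noteq> 0" "c = abs_pline w" by (rule pline_cases)
  obtain x where x: "x \<noteq> 0" "d = abs_pline x" by (rule pline_cases)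
  obtain y where y: "y \<noteq> 0" "d' = abs_pline y" by (rule pline_cases)
  note nz = u(1) v(1) w(1) x(1) y(1) and rep = u(2) v(2) w(2) x(2) y(2)
  have br: "bracket u v \<noteq> 0" "bracket u w \<noteq> 0" "bracket v w \<noteq> 0"
    "bracket u x \<noteq> 0" "bracket u y \<noteq> 0"
    using assms(1-5) nz by (simp_all add: rep abs_pline_eq_iff)
  have "bracket u w * bracket v x * (bracket u y * bracket v w) =
      bracket u w * bracket v y * (bracket u x * bracket v w)"
    using eq br by (simp add: rep cross_ratio_abs nz frac_eq_eq)
  then have "bracket u w * bracket v w *
      (bracket v x * bracket u y - bracket v y * bracket u x) = 0"
    by (simp add: algebra_simps)
  then have "bracket v x * bracket u y - bracket v y * bracket u x = 0"
    using br by simp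
  \<comment> \<open>the Pluecker relation among four vectors of the plane\<close>
  moreover have "bracket v x * bracket u y - bracket v y * bracket u x = - bracket u v * bracket x y"
    by (simp add: bracket_def algebra_simps)
  ultimately have "bracket x y = 0" using br by simp
  then show ?thesis by (simp add: rep nz abs_pline_eq_iff)
qed

text \<open>The fixed points of a transformation are the roots of a quadratic form, which vanishes
  identically once it has three roots.\<close>

lemma matrix_fixing_three_points:
  fixes N :: "'a::field ^ 2 ^ 2"
  assumes "a \<noteq> b" "a \<noteq> c" "b \<noteq> c"
    and fixed: "\<And>z. z \<in> {a, b, c} \<Longrightarrow> bracket (N *v vector [z, 1]) (vector [z, 1]) = 0"
  shows "\<exists>k. N = mat k"
proof -
  let ?P = "\<lambda>z. N$2$1 * z * z + (N$2$2 - N$1$1) * z - N$1$2"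
  have root: "?P z = 0" if "z \<in> {a, b, c}" for z
    using fixed[OF that] by (simp add: bracket_def matrix2_simps algebra_simps)
  have "?P a - ?P b = (a - b) * (N$2$1 * (a + b) + (N$2$2 - N$1$1))"
    "?P a - ?P c = (a - c) * (N$2$1 * (a + c) + (N$2$2 - N$1$1))"
    by (simp_all add: algebra_simps)
  then have ab: "N$2$1 * (a + b) + (N$2$2 - N$1$1) = 0"
    and ac: "N$2$1 * (a + c) + (N$2$2 - N$1$1) = 0"
    using root assms by simp_all
  have "N$2$1 * (b - c) =
      (N$2$1 * (a + b) + (N$2$2 - N$1$1)) - (N$2$1 * (a + c) + (N$2$2 - N$1$1))"
    by (simp add: algebra_simps)
  then have "N$2$1 * (b - c) = 0" using ab ac by simp
  then have 21: "N$2$1 = 0" using assms by simp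
  then have 22: "N$2$2 = N$1$1" using ab by simp
  then have "N$1$2 = 0" using 21 root[of a] by simp
  then have "N = mat (N$1$1)" using 21 22 by (simp add: matrix2_simps)
  then show ?thesis ..
qed

lemma pgl2_eqI_three_points:
  fixes A B :: "'a::field ^ 2 ^ 2"
  assumes inv: "invertible A" "invertible B" and "a \<noteq> b" "a \<noteq> c" "b \<noteq> c"
    and agree: "\<And>z. z \<in> {a, b, c} \<Longrightarrow>
      pgl2_act (abs_pgl2 A) (affine_point z) = pgl2_act (abs_pgl2 B) (affine_point z)"
  shows "abs_pgl2 A = abs_pgl2 B"
proof -
  obtain C where C: "C ** A = mat 1" "A ** C = mat 1" using inv by (auto simp: invertible_def)
  have iC: "invertible C" using C by (auto simp: invertible_def)
  have "bracket ((C ** B) *v vector [z, 1]) (vector [z, 1]) = 0" if "z \<in> {a, b, c}" for z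
  proof -
    have "bracket (A *v vector [z, 1]) (B *v vector [z, 1]) = 0"
      using agree[OF that] inv by (simp add: affine_point.abs_eq pgl2_act_abs vector_1_nonzero
          abs_pline_eq_iff invertible_mult_nonzero)
    then have "bracket (C *v (A *v vector [z, 1])) (C *v (B *v vector [z, 1])) = 0"
      by (simp add: bracket_mult)
    then show ?thesis by (simp add: matrix_vector_mul_assoc C bracket_def)
  qed
  then obtain k where k: "C ** B = mat k"
    using matrix_fixing_three_points[of a b c "C ** B"] assms by blast
  have "B = A ** (C ** B)" using C by (simp add: matrix_mul_assoc)
  then have "B = map_matrix ((*) k) A" unfolding k by (simp add: matrix2_simps mult.commute)
  moreover from this have "k \<noteq> 0"
    using inv by (auto simp: invertible_det_nz det_2)
  ultimately show ?thesis using inv abs_pgl2_eq_iff by blast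
qed

section \<open>Developing a polygon by dilations of its edges\<close>

text \<open>Over the affine points \<open>a \<noteq> b\<close> the edge matrix is the projection onto the line of \<open>a\<close> along the
  line of \<open>b\<close>.  A dilation therefore fixes both points, with eigenvalues \<open>1 + s\<close> at \<open>a\<close> and \<open>1\<close> at
  \<open>b\<close>: it is an element of the one-dimensional torus attached to the edge.\<close>

definition dilation :: "'a::field \<Rightarrow> 'a \<Rightarrow> 'a \<Rightarrow> 'a ^ 2 ^ 2" where
  "dilation s a b = mat 1 + map_matrix ((*) s) (edge_matrix a b)"

lemma det_dilation: "a \<noteq> b \<Longrightarrow> det (dilation s a b) = 1 + s"
  by (simp add: dilation_def edge_matrix_def det_2 mat_def divide_simps)
    (simp add: algebra_simps)

lemma dilation_fixes_left:
  "a \<noteq> b \<Longrightarrow> dilation s a b *v vector [a, 1] = (1 + s) *s vector [a, 1]"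
  by (simp add: dilation_def edge_matrix_def matrix2_simps divide_simps)
    (simp add: algebra_simps)

lemma dilation_fixes_right: "a \<noteq> b \<Longrightarrow> dilation s a b *v vector [b, 1] = vector [b, 1]"
  by (simp add: dilation_def edge_matrix_def matrix2_simps divide_simps)
    (simp add: algebra_simps)

lemma invertible_dilation: "a \<noteq> b \<Longrightarrow> 1 + s \<noteq> 0 \<Longrightarrow> invertible (dilation s a b)"
  by (simp add: invertible_det_nz det_dilation)

lemma dilation_act:
  assumes "a \<noteq> b" "1 + s \<noteq> 0"
  shows "pgl2_act (abs_pgl2 (dilation s a b)) (affine_point a) = affine_point a"
    and "pgl2_act (abs_pgl2 (dilation s a b)) (affine_point b) = affine_point b"
  using assms by (simp_all add: affine_point.abs_eq pgl2_act_abs invertible_dilation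
      vector_1_nonzero dilation_fixes_left dilation_fixes_right abs_pline_smult
      del: vector_sadd_rdistrib)

text \<open>Dilating along the edge from \<open>a\<close> to \<open>b\<close> leaves \<open>bracket a d\<close> unchanged and multiplies
  \<open>bracket b d\<close> by the determinant, because \<open>a\<close> and \<open>b\<close> are eigenvectors.  This is the reason why
  dilations are the right tool for rescaling cross-ratio coordinates.\<close>

lemma cross_ratio_dilation:
  assumes "a \<noteq> b" "1 + s \<noteq> 0"
  shows "cross_ratio (affine_point a) (affine_point b) c (pgl2_act (abs_pgl2 (dilation s a b)) d)
    = (1 + s) * cross_ratio (affine_point a) (affine_point b) c d"
proof -
  let ?D = "dilation s a b" and ?a = "vector [a, 1]" and ?b = "vector [b, 1]"
  obtain v w where nz: "v \<noteq> 0" "w \<noteq> 0" and rep: "c = abs_pline v" "d = abs_pline w"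
    by (metis pline_cases)
  have inv: "invertible ?D" using assms by (rule invertible_dilation)
  have "(1 + s) * bracket ?a (?D *v w) = bracket (?D *v ?a) (?D *v w)"
    by (simp add: dilation_fixes_left assms bracket_def algebra_simps)
  then have a: "bracket ?a (?D *v w) = bracket ?a w"
    using assms by (simp add: bracket_mult det_dilation)
  have "bracket ?b (?D *v w) = bracket (?D *v ?b) (?D *v w)"
    by (simp add: dilation_fixes_right assms)
  then have b: "bracket ?b (?D *v w) = (1 + s) * bracket ?b w"
    using assms by (simp add: bracket_mult det_dilation)
  show ?thesis
    by (simp add: rep affine_point.abs_eq pgl2_act_abs cross_ratio_abs inv nz vector_1_nonzero
        invertible_mult_nonzero a b)
qed

text \<open>The two-sided product of the steps \<open>S i\<close>, normalised to be trivial at index 1, where the sum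
  over the edges starts in the formula for the monodromy.\<close>

lemma exists_development:
  fixes S :: "int \<Rightarrow> 'a::field ^ 2 ^ 2"
  assumes "\<And>i. invertible (S i)"
  obtains H where "H 1 = mat 1" and "\<And>i. H (i + 1) = H i ** S i" and "\<And>i. invertible (H i)"
proof -
  obtain T where T: "\<And>i. T i ** S i = mat 1" "\<And>i. S i ** T i = mat 1"
    using assms unfolding invertible_def by metis
  define pos where "pos = rec_nat (mat 1) (\<lambda>k A. A ** S (int k + 1))"
  define neg where "neg = rec_nat (mat 1) (\<lambda>k A. A ** T (- int k))"
  have pos: "pos 0 = mat 1" "\<And>k. pos (Suc k) = pos k ** S (int k + 1)"
    and neg: "neg 0 = mat 1" "\<And>k. neg (Suc k) = neg k ** T (- int k)"
    by (simp_all add: pos_def neg_def)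
  define H where "H i = (if 1 \<le> i then pos (nat (i - 1)) else neg (nat (1 - i)))" for i
  have H1: "H 1 = mat 1" by (simp add: H_def pos)
  have step: "H (i + 1) = H i ** S i" for i
  proof (cases "1 \<le> i")
    case True
    then have "nat (i + 1 - 1) = Suc (nat (i - 1))" "int (nat (i - 1)) + 1 = i" by simp_all
    then show ?thesis using True pos(2)[of "nat (i - 1)"] by (simp add: H_def)
  next
    case False
    then have "nat (1 - i) = Suc (nat (- i))" "- int (nat (- i)) = i" by simp_all
    then have "H i = neg (nat (- i)) ** T i"
      using False neg(2)[of "nat (- i)"] by (simp add: H_def)
    moreover have "H (i + 1) = neg (nat (- i))"
      using False by (cases "i = 0") (simp_all add: H_def pos neg)
    ultimately show ?thesis by (simp add: matrix_mul_assoc[symmetric] T)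
  qed
  have "invertible (H i)" for i
  proof (induction i rule: int_induct[of _ 1])
    case base show ?case by (simp add: H1 invertible_det_nz)
  next
    case (step1 i) then show ?case using assms by (simp add: step invertible_mult)
  next
    case (step2 i)
    have "det (H (i - 1)) * det (S (i - 1)) = det (H i)"
      using step[of "i - 1"] by (simp add: det_mul)
    then show ?case using step2 by (auto simp: invertible_det_nz)
  qed
  then show thesis using H1 step that by blast
qed

text \<open>With periodic steps, shifting the index by a period is left multiplication by one fixed matrix:
  this matrix is the monodromy of the developed polygon.\<close>

lemma development_periodic:
  fixes H S :: "int \<Rightarrow> 'a::field ^ 2 ^ 2"
  assumes H1: "H 1 = mat 1" and step: "\<And>i. H (i + 1) = H i ** S i"
    and inv: "\<And>i. invertible (S i)" and per: "\<And>i. S (i + m) = S i"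
  shows "H (i + m) = H (m + 1) ** H i"
proof (induction i rule: int_induct[of _ 1])
  case base show ?case by (simp add: H1 add.commute)
next
  case (step1 i)
  have "H (i + 1 + m) = H (i + m) ** S i"
    using step[of "i + m"] per[of i] by (simp add: algebra_simps)
  then show ?case using step1 by (simp add: step matrix_mul_assoc)
next
  case (step2 i)
  obtain T where T: "S (i - 1) ** T = mat 1" using inv[of "i - 1"] by (auto simp: invertible_def)
  have "H (i - 1 + m) ** S (i - 1) = H (i + m)"
    using step[of "i - 1 + m"] per[of "i - 1"] by (simp add: algebra_simps)
  also have "\<dots> = H (m + 1) ** H (i - 1) ** S (i - 1)"
    using step2 step[of "i - 1"] by (simp add: matrix_mul_assoc)
  finally have "H (i - 1 + m) ** S (i - 1) ** T = H (m + 1) ** H (i - 1) ** S (i - 1) ** T"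
    by simp
  then show ?case by (simp add: matrix_mul_assoc[symmetric] T)
qed

text \<open>A reference polygon \<open>y\<close> is deformed by moving its vertex \<open>y i\<close> with the frame \<open>G i\<close>, where
  consecutive frames differ by a dilation of the edge between them.  Since that dilation fixes both
  ends of the edge, \<open>G i\<close> moves three consecutive vertices of the reference polygon to their new
  positions.\<close>

locale developed_polygon =
  fixes y s :: "int \<Rightarrow> 'a::field" and G :: "int \<Rightarrow> 'a ^ 2 ^ 2"
  assumes distinct: "y i \<noteq> y (i + 1)" "y i \<noteq> y (i + 2)"
    and factor_nonzero: "1 + s i \<noteq> 0"
    and invertible_frame: "invertible (G i)"
    and frame_step: "G (i + 1) = G i ** dilation (s i) (y i) (y (i + 1))"
begin

definition vertex :: "int \<Rightarrow> 'a pline" where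
  "vertex i = pgl2_act (abs_pgl2 (G i)) (affine_point (y i))"

lemma frame_step_act:
  "pgl2_act (abs_pgl2 (G (i + 1))) p =
    pgl2_act (abs_pgl2 (G i)) (pgl2_act (abs_pgl2 (dilation (s i) (y i) (y (i + 1)))) p)"
  by (simp add: frame_step pgl2_act_mult invertible_frame invertible_dilation distinct
      factor_nonzero)

lemma frame_next: "pgl2_act (abs_pgl2 (G i)) (affine_point (y (i + 1))) = vertex (i + 1)"
  by (simp add: vertex_def frame_step_act dilation_act distinct factor_nonzero)

lemma frame_previous: "pgl2_act (abs_pgl2 (G i)) (affine_point (y (i - 1))) = vertex (i - 1)"
  using frame_step_act[of "i - 1" "affine_point (y (i - 1))"] distinct[of "i - 1"]
  by (simp add: vertex_def dilation_act factor_nonzero)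

lemma frame_next_next:
  "pgl2_act (abs_pgl2 (G i)) (pgl2_act (abs_pgl2 (dilation (s i) (y i) (y (i + 1))))
      (affine_point (y (i + 2)))) = vertex (i + 2)"
  using frame_next[of "i + 1"] by (simp add: frame_step_act add.assoc)

lemma vertex_distinct: "vertex i \<noteq> vertex (i + 1)" "vertex i \<noteq> vertex (i + 2)"
proof -
  show "vertex i \<noteq> vertex (i + 1)"
    unfolding frame_next[symmetric] vertex_def[of i]
    by (simp add: pgl2_act_inject invertible_frame affine_point_eq_iff distinct)
  have "vertex i = pgl2_act (abs_pgl2 (G (i + 1))) (affine_point (y i))"
    and "vertex (i + 2) = pgl2_act (abs_pgl2 (G (i + 1))) (affine_point (y (i + 2)))"
    using frame_previous[of "i + 1"] frame_next[of "i + 1"] by (simp_all add: add.assoc)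
  then show "vertex i \<noteq> vertex (i + 2)"
    by (simp add: pgl2_act_inject invertible_frame affine_point_eq_iff distinct)
qed

text \<open>Seen from the frame \<open>G i\<close>, only the fourth of the points entering the coordinate has moved, and
  it has moved by the dilation of the edge \<open>i\<close>.\<close>

lemma cross_ratio_coord_vertex:
  "cross_ratio_coord vertex i = (1 + s i) * cross_ratio_coord (\<lambda>i. affine_point (y i)) i"
  unfolding cross_ratio_coord_def frame_previous[symmetric] frame_next[symmetric]
    frame_next_next[symmetric] vertex_def[of i]
  by (simp add: cross_ratio_act invertible_frame cross_ratio_dilation distinct factor_nonzero)

text \<open>Three consecutive vertices and a cross-ratio coordinate determine the next vertex, so every
  polygon with the coordinates of the developed one and the same first three vertices agrees with
  it from there on.\<close>

lemma vertex_unique: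
  fixes q :: "int \<Rightarrow> 'a pline" and k :: nat
  assumes q_distinct: "\<And>i. q i \<noteq> q (i + 1)" "\<And>i. q i \<noteq> q (i + 2)"
    and coord: "\<And>i. cross_ratio_coord q i = cross_ratio_coord vertex i"
    and start: "q 0 = vertex 0" "q 1 = vertex 1" "q 2 = vertex 2"
  shows "q (int k) = vertex (int k)"
proof -
  have "q (int k) = vertex (int k) \<and> q (int k + 1) = vertex (int k + 1) \<and>
    q (int k + 2) = vertex (int k + 2)"
  proof (induction k)
    case 0 show ?case using start by simp
  next
    case (Suc k)
    let ?i = "int k + 1"
    have "cross_ratio (q ?i) (q (?i + 1)) (q (?i - 1)) (q (?i + 2)) =
        cross_ratio (q ?i) (q (?i + 1)) (q (?i - 1)) (vertex (?i + 2))"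
      using coord[of ?i] Suc by (simp add: cross_ratio_coord_def add.assoc)
    moreover have "q ?i \<noteq> q (?i + 1)" "q ?i \<noteq> q (?i - 1)" "q (?i + 1) \<noteq> q (?i - 1)"
      "q ?i \<noteq> q (?i + 2)"
      using q_distinct[of ?i] q_distinct[of "int k"] by (auto simp: add.assoc)
    moreover have "q ?i \<noteq> vertex (?i + 2)"
      using Suc vertex_distinct[of ?i] by simp
    ultimately have "q (?i + 2) = vertex (?i + 2)"
      using cross_ratio_determines_last by blast
    then show ?case using Suc by (simp add: ac_simps)
  qed
  then show ?thesis by blast
qed

end

section \<open>First-order expansions at \<open>t = 1\<close>\<close>

abbreviation generic_matrix :: "'a::field poly ^ 2 ^ 2 \<Rightarrow> 'a poly fract ^ 2 ^ 2" where
  "generic_matrix \<equiv> map_matrix to_fract"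

abbreviation matrix_at_1 :: "'a::field poly ^ 2 ^ 2 \<Rightarrow> 'a ^ 2 ^ 2" where
  "matrix_at_1 \<equiv> map_matrix (\<lambda>f. poly f 1)"

abbreviation matrix_deriv_at_1 :: "'a::field poly ^ 2 ^ 2 \<Rightarrow> 'a ^ 2 ^ 2" where
  "matrix_deriv_at_1 \<equiv> map_matrix (\<lambda>f. poly (pderiv f) 1)"

text \<open>The matrix \<open>G\<close> is, up to a scalar, a curve in \<open>PGL\<^sub>2\<close> through the identity at \<open>t = 1\<close>, with velocity
  \<open>X\<close> there.  The factor \<open>c\<close> clears denominators; since its derivative contributes a multiple of the
  identity to the derivative of the polynomial matrix, \<open>X\<close> is only constrained modulo scalars.\<close>

definition tangent_at_1 :: "'a::field poly fract ^ 2 ^ 2 \<Rightarrow> 'a ^ 2 ^ 2 \<Rightarrow> bool" where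
  "tangent_at_1 G X \<longleftrightarrow> (\<exists>A c k. c \<noteq> 0 \<and> matrix_at_1 A = mat 1 \<and>
     generic_matrix A = map_matrix ((*) c) G \<and> matrix_deriv_at_1 A = X + mat k)"

lemma generic_matrix_mult: "generic_matrix (A ** B) = generic_matrix A ** generic_matrix B"
  by (simp add: matrix2_simps)

lemma det_matrix_at_1: "det (matrix_at_1 A) = poly (det A) 1"
  by (simp add: det_2)

lemma det_generic_matrix: "det (generic_matrix A) = to_fract (det A)"
  by (simp add: det_2)

lemma invertible_generic_matrix:
  assumes "invertible (matrix_at_1 A)"
  shows "invertible (generic_matrix A)"
  using assms by (auto simp: invertible_det_nz det_matrix_at_1 det_generic_matrix)

lemma invertible_mat_1: "invertible (mat 1 :: 'a::field ^ 2 ^ 2)"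
  by (simp add: invertible_det_nz)

lemma det_map_matrix_times: "det (map_matrix ((*) c) A) = c * c * det (A :: 'a::field ^ 2 ^ 2)"
  by (simp add: det_2 algebra_simps)

lemma tangent_at_1_invertible:
  assumes "tangent_at_1 G X"
  shows "invertible G"
proof -
  obtain A c where "c \<noteq> 0" "matrix_at_1 A = mat 1" "generic_matrix A = map_matrix ((*) c) G"
    using assms by (auto simp: tangent_at_1_def)
  then have "invertible (map_matrix ((*) c) G)"
    by (metis invertible_generic_matrix invertible_mat_1)
  then show ?thesis using \<open>c \<noteq> 0\<close> by (simp add: invertible_det_nz det_map_matrix_times)
qed

lemma tangent_at_1_id: "tangent_at_1 (mat 1) 0"
  unfolding tangent_at_1_def
  by (rule exI[of _ "mat 1"], rule exI[of _ 1], rule exI[of _ 0]) (simp add: matrix2_simps)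

lemma tangent_at_1_mult:
  assumes "tangent_at_1 G X" "tangent_at_1 H Y"
  shows "tangent_at_1 (G ** H) (X + Y)"
proof -
  obtain A c k where A: "c \<noteq> 0" "matrix_at_1 A = mat 1" "generic_matrix A = map_matrix ((*) c) G"
    "matrix_deriv_at_1 A = X + mat k"
    using assms(1) by (auto simp: tangent_at_1_def)
  obtain B d l where B: "d \<noteq> 0" "matrix_at_1 B = mat 1" "generic_matrix B = map_matrix ((*) d) H"
    "matrix_deriv_at_1 B = Y + mat l"
    using assms(2) by (auto simp: tangent_at_1_def)
  have "matrix_at_1 (A ** B) = matrix_at_1 A ** matrix_at_1 B"
    by (simp add: matrix2_simps)
  then have 1: "matrix_at_1 (A ** B) = mat 1" using A B by simp
  have 2: "generic_matrix (A ** B) = map_matrix ((*) (c * d)) (G ** H)"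
    unfolding generic_matrix_mult A B by (simp add: matrix2_simps algebra_simps)
  have "matrix_deriv_at_1 (A ** B) =
      matrix_deriv_at_1 A ** matrix_at_1 B + matrix_at_1 A ** matrix_deriv_at_1 B"
    by (simp add: matrix2_simps pderiv_mult pderiv_add algebra_simps)
  then have 3: "matrix_deriv_at_1 (A ** B) = (X + Y) + mat (k + l)"
    unfolding A B by (simp add: matrix2_simps)
  have "c * d \<noteq> 0" using A(1) B(1) by simp
  then show ?thesis unfolding tangent_at_1_def using 1 2 3 by blast
qed

definition adjugate2 :: "'a::comm_ring_1 ^ 2 ^ 2 \<Rightarrow> 'a ^ 2 ^ 2" where
  "adjugate2 A = vector [vector [A$2$2, - A$1$2], vector [- A$2$1, A$1$1]]"

text \<open>Up to the factor \<open>det G\<close> the inverse is the adjugate, which is again a polynomial matrix after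
  clearing denominators and whose derivative is minus that of the matrix plus its trace.\<close>

lemma tangent_at_1_inverse:
  assumes "tangent_at_1 G X" and "G ** H = mat 1"
  shows "tangent_at_1 H (- X)"
proof -
  obtain A c k where A: "c \<noteq> 0" "matrix_at_1 A = mat 1" "generic_matrix A = map_matrix ((*) c) G"
    "matrix_deriv_at_1 A = X + mat k"
    using assms(1) by (auto simp: tangent_at_1_def)
  have 1: "matrix_at_1 (adjugate2 A) = mat 1"
    using A(2) by (simp add: adjugate2_def matrix2_simps)
  have "adjugate2 G ** G = mat (det G)"
    by (simp add: adjugate2_def matrix2_simps det_2 algebra_simps)
  then have "adjugate2 G ** (G ** H) = mat (det G) ** H"
    by (simp add: matrix_mul_assoc)
  then have "adjugate2 G = map_matrix ((*) (det G)) H"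
    by (simp add: assms) (simp add: matrix2_simps)
  moreover have "generic_matrix (adjugate2 A) = map_matrix ((*) c) (adjugate2 G)"
    using A(3) by (simp add: adjugate2_def vec_eq_iff forall_2)
  ultimately have 2: "generic_matrix (adjugate2 A) = map_matrix ((*) (c * det G)) H"
    by (simp add: vec_eq_iff)
  have 3: "matrix_deriv_at_1 (adjugate2 A) = - X + mat (X$1$1 + X$2$2 + k)"
    using A(4) by (simp add: adjugate2_def matrix2_simps pderiv_minus)
  have "c * det G \<noteq> 0"
    using A(1) tangent_at_1_invertible[OF assms(1)] by (simp add: invertible_det_nz)
  then show ?thesis unfolding tangent_at_1_def using 1 2 3 by blast
qed

text \<open>Two polynomial matrices \<open>A\<close> and \<open>B\<close> representing the same curve satisfy \<open>B$1$1 * A = A$1$1 * B\<close>;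
  differentiating at \<open>t = 1\<close>, where both are the identity, compares their derivatives.\<close>

lemma tangent_at_1_unique:
  assumes "tangent_at_1 G X" "tangent_at_1 G Y"
  shows "\<exists>k. Y = X + mat k"
proof -
  obtain A c k where A: "c \<noteq> 0" "matrix_at_1 A = mat 1" "generic_matrix A = map_matrix ((*) c) G"
    "matrix_deriv_at_1 A = X + mat k"
    using assms(1) by (auto simp: tangent_at_1_def)
  obtain B d l where B: "d \<noteq> 0" "matrix_at_1 B = mat 1" "generic_matrix B = map_matrix ((*) d) G"
    "matrix_deriv_at_1 B = Y + mat l"
    using assms(2) by (auto simp: tangent_at_1_def)
  let ?a = "A$1$1" and ?b = "B$1$1"
  have "?b * A$i$j = ?a * B$i$j" for i j
  proof -
    have "to_fract (A$i$j) = c * G$i$j" "to_fract (B$i$j) = d * G$i$j" for i j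
      using A(3) B(3) by (simp_all add: vec_eq_iff)
    then have "to_fract (?b * A$i$j) = to_fract (?a * B$i$j)" by simp
    then show ?thesis by (simp only: to_fract_eq_iff)
  qed
  then have "pderiv (?b * A$i$j) = pderiv (?a * B$i$j)" for i j by simp
  then have deriv: "poly (pderiv (?b * A$i$j)) 1 = poly (pderiv (?a * B$i$j)) 1" for i j
    by metis
  have entries: "poly (A$i$j) 1 = (if i = j then 1 else 0)"
    "poly (B$i$j) 1 = (if i = j then 1 else 0)"
    "poly (pderiv (A$i$j)) 1 = X$i$j + (if i = j then k else 0)"
    "poly (pderiv (B$i$j)) 1 = Y$i$j + (if i = j then l else 0)" for i j
    using A(2,4) B(2,4) by (simp_all add: vec_eq_iff mat_def)
  define m where "m = Y$1$1 - X$1$1"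
  have "Y$i$j = X$i$j + (if i = j then m else 0)" for i j
    using deriv[of i j]
    by (cases "i = j") (simp_all add: entries m_def pderiv_mult algebra_simps)
  then have "Y = X + mat m"
    by (simp add: vec_eq_iff mat_def)
  then show ?thesis ..
qed

lemma velocity_at_1_iff_tangent:
  assumes "invertible G"
  shows "velocity_at_1 (abs_pgl2 G) \<xi> \<longleftrightarrow> (\<exists>X. tangent_at_1 G X \<and> \<xi> = abs_lie_pgl2 X)"
proof
  assume "velocity_at_1 (abs_pgl2 G) \<xi>"
  then obtain A where A: "matrix_at_1 A = mat 1" "abs_pgl2 G = abs_pgl2 (generic_matrix A)"
    "\<xi> = abs_lie_pgl2 (matrix_deriv_at_1 A)"
    by (auto simp: velocity_at_1_def)
  have "invertible (generic_matrix A)"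
    using A(1) by (simp add: invertible_generic_matrix invertible_mat_1)
  then obtain c where "c \<noteq> 0" "generic_matrix A = map_matrix ((*) c) G"
    using A(2) assms abs_pgl2_eq_iff by metis
  then have "tangent_at_1 G (matrix_deriv_at_1 A)"
    unfolding tangent_at_1_def using A(1)
    by (intro exI[of _ A] exI[of _ c] exI[of _ 0]) (simp add: vec_eq_iff mat_def)
  then show "\<exists>X. tangent_at_1 G X \<and> \<xi> = abs_lie_pgl2 X" using A(3) by blast
next
  assume "\<exists>X. tangent_at_1 G X \<and> \<xi> = abs_lie_pgl2 X"
  then obtain X A c k where A: "c \<noteq> 0" "matrix_at_1 A = mat 1"
    "generic_matrix A = map_matrix ((*) c) G" "matrix_deriv_at_1 A = X + mat k"
    and \<xi>: "\<xi> = abs_lie_pgl2 X"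
    by (auto simp: tangent_at_1_def)
  have "invertible (generic_matrix A)"
    using A(2) by (simp add: invertible_generic_matrix invertible_mat_1)
  then have "abs_pgl2 G = abs_pgl2 (generic_matrix A)"
    using A assms abs_pgl2_eq_iff by blast
  moreover have "\<xi> = abs_lie_pgl2 (matrix_deriv_at_1 A)"
    unfolding \<xi> lie_pgl2.abs_eq_iff same_mod_scalars_def A(4) by blast
  ultimately show "velocity_at_1 (abs_pgl2 G) \<xi>"
    unfolding velocity_at_1_def using A(2) by blast
qed

lemma velocity_at_1_tangent:
  assumes "tangent_at_1 G X"
  shows "velocity_at_1 (abs_pgl2 G) \<xi> \<longleftrightarrow> \<xi> = abs_lie_pgl2 X"
  using assms tangent_at_1_unique tangent_at_1_invertible[OF assms]
  unfolding velocity_at_1_iff_tangent[OF tangent_at_1_invertible[OF assms]]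
  by (metis lie_pgl2.abs_eq_iff same_mod_scalars_def)

lemma pgl2_at_1_tangent:
  assumes "tangent_at_1 G X"
  shows "pgl2_at_1 (abs_pgl2 G) pgl2_id"
proof -
  obtain A c where A: "c \<noteq> 0" "matrix_at_1 A = mat 1" "generic_matrix A = map_matrix ((*) c) G"
    using assms by (auto simp: tangent_at_1_def)
  have "abs_pgl2 G = abs_pgl2 (generic_matrix A)"
    using A tangent_at_1_invertible[OF assms] abs_pgl2_eq_iff
    by (metis invertible_generic_matrix invertible_mat_1)
  then show ?thesis unfolding pgl2_at_1_def
    using A(2) by (intro exI[of _ A]) (simp add: pgl2_id.abs_eq invertible_mat_1)
qed

lemma to_fract_smult: "to_fract (smult a f) = const_fract a * to_fract f"
proof -
  have "smult a f = [:a:] * f" by simp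
  then show ?thesis unfolding const_fract_def by (simp only: to_fract_mult)
qed

lemma point_at_1I:
  assumes "q = abs_pline (vector [to_fract f, to_fract g])" "poly f 1 = a" "poly g 1 = 1"
  shows "point_at_1 q (affine_point a)"
  unfolding point_at_1_def affine_point.abs_eq
  by (rule exI[of _ f], rule exI[of _ g]) (simp add: assms)

lemma point_at_1_tangent:
  assumes "tangent_at_1 G X"
  shows "point_at_1 (pgl2_act (abs_pgl2 G) (affine_point (const_fract a))) (affine_point a)"
proof -
  obtain A c where A: "c \<noteq> 0" "matrix_at_1 A = mat 1" "generic_matrix A = map_matrix ((*) c) G"
    using assms by (auto simp: tangent_at_1_def)
  let ?v = "vector [const_fract a, 1]" and ?w = "A *v vector [[:a:], 1]"
  have inv: "invertible G" using assms by (rule tangent_at_1_invertible)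
  have "pgl2_act (abs_pgl2 G) (affine_point (const_fract a)) = abs_pline (c *s (G *v ?v))"
    using A(1) inv by (simp add: affine_point.abs_eq pgl2_act_abs vector_1_nonzero
        abs_pline_smult invertible_mult_nonzero)
  also have "c *s (G *v ?v) = vector [to_fract (?w$1), to_fract (?w$2)]"
    using A(3) by (simp add: matrix2_simps to_fract_smult algebra_simps)
  finally have 1: "pgl2_act (abs_pgl2 G) (affine_point (const_fract a)) =
      abs_pline (vector [to_fract (?w$1), to_fract (?w$2)])" .
  have 2: "poly (?w$1) 1 = a" "poly (?w$2) 1 = 1"
    using A(2) by (simp_all add: matrix2_simps)
  show ?thesis using 1 2 by (rule point_at_1I)
qed

section \<open>Frames that are regular at \<open>t = 1\<close>\<close>

lemma const_fract_0: "const_fract 0 = 0"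
  and const_fract_1: "const_fract 1 = 1"
  and const_fract_mult: "const_fract (a * b) = const_fract a * const_fract b"
  and const_fract_diff: "const_fract (a - b) = const_fract a - const_fract b"
  and const_fract_minus: "const_fract (- a) = - const_fract a"
  and const_fract_eq_iff: "const_fract a = const_fract b \<longleftrightarrow> a = b"
  by (simp_all add: const_fract_def flip: to_fract_mult to_fract_diff to_fract_uminus)
    (simp add: one_pCons[symmetric])

lemma const_fract_divide:
  "const_fract (a / b) = const_fract a / const_fract b"
proof (cases "b = 0")
  case False
  then have "const_fract a = const_fract (a / b) * const_fract b"
    by (simp flip: const_fract_mult)
  moreover have "const_fract b \<noteq> 0"
    using False by (simp add: const_fract_0[symmetric] const_fract_eq_iff)
  ultimately show ?thesis by simp
qed (simp add: const_fract_0)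

lemma cross_ratio_coord_const:
  "cross_ratio_coord (\<lambda>i. affine_point (const_fract (x i))) i =
    const_fract (cross_ratio_coord (\<lambda>i. affine_point (x i)) i)"
  by (simp add: cross_ratio_coord_def cross_ratio_affine const_fract_mult const_fract_divide
      const_fract_diff)

lemma point_at_1_affineE:
  assumes "point_at_1 q (affine_point a)"
  obtains f g where "q = abs_pline (vector [to_fract f, to_fract g])" "poly f 1 = a" "poly g 1 = 1"
proof -
  obtain f g where nz: "poly f 1 \<noteq> 0 \<or> poly g 1 \<noteq> 0"
    and q: "q = abs_pline (vector [to_fract f, to_fract g])"
    and a: "affine_point a = abs_pline (vector [poly f 1, poly g 1])"
    using assms by (auto simp: point_at_1_def)
  have "vector [poly f 1, poly g 1] \<noteq> (0 :: 'a ^ 2)"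
    using nz by (auto simp: vec_eq_iff forall_2)
  then have f: "poly f 1 = a * poly g 1"
    using a by (simp add: affine_point.abs_eq abs_pline_eq_iff vector_1_nonzero bracket_def)
  then have g: "poly g 1 \<noteq> 0" using nz by auto
  then have "g \<noteq> 0" by auto
  let ?k = "1 / poly g 1"
  have "const_fract ?k \<noteq> 0"
    using g by (simp add: const_fract_0[symmetric] const_fract_eq_iff)
  moreover have "vector [to_fract f, to_fract g] \<noteq> (0 :: 'a poly fract ^ 2)"
    using \<open>g \<noteq> 0\<close> by (simp add: vec_eq_iff forall_2)
  ultimately have "q = abs_pline (const_fract ?k *s vector [to_fract f, to_fract g])"
    unfolding q by (simp add: abs_pline_smult)
  also have "const_fract ?k *s vector [to_fract f, to_fract g] =
      (vector [to_fract (smult ?k f), to_fract (smult ?k g)] :: 'a poly fract ^ 2)"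
    by (simp add: vec_eq_iff forall_2 to_fract_smult)
  finally show thesis using that[of "smult ?k f" "smult ?k g"] f g by simp
qed

text \<open>Three points regular at \<open>t = 1\<close> are the images of their limits under a transformation that is
  the identity at \<open>t = 1\<close>.  This is what makes the monodromy of an arbitrary lift comparable with
  that of the standard one.\<close>

lemma exists_frame_at_1:
  fixes a0 a1 a2 :: "'a::field"
  assumes distinct: "a0 \<noteq> a1" "a0 \<noteq> a2" "a1 \<noteq> a2"
    and "point_at_1 q0 (affine_point a0)" "point_at_1 q1 (affine_point a1)"
      "point_at_1 q2 (affine_point a2)"
  obtains G X where "tangent_at_1 G X"
    and "pgl2_act (abs_pgl2 G) (affine_point (const_fract a0)) = q0"
    and "pgl2_act (abs_pgl2 G) (affine_point (const_fract a1)) = q1"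
    and "pgl2_act (abs_pgl2 G) (affine_point (const_fract a2)) = q2"
proof -
  obtain f0 g0 where 0: "q0 = abs_pline (vector [to_fract f0, to_fract g0])"
    "poly f0 1 = a0" "poly g0 1 = 1"
    using assms(4) by (rule point_at_1_affineE)
  obtain f1 g1 where 1: "q1 = abs_pline (vector [to_fract f1, to_fract g1])"
    "poly f1 1 = a1" "poly g1 1 = 1"
    using assms(5) by (rule point_at_1_affineE)
  obtain f2 g2 where 2: "q2 = abs_pline (vector [to_fract f2, to_fract g2])"
    "poly f2 1 = a2" "poly g2 1 = 1"
    using assms(6) by (rule point_at_1_affineE)
  \<comment> \<open>With lifts \<open>V0, V1, V2\<close> of the points, the matrix below sends \<open>(z, 1)\<close> to
    \<open>(z - a2) * u * V0 + (a0 - z) * v * V2\<close>.  This passes through \<open>V0\<close> at \<open>z = a0\<close> and through \<open>V2\<close> at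
    \<open>z = a2\<close>; at \<open>z = a1\<close> the coefficients of \<open>V0\<close> and \<open>V2\<close> are a common multiple of those
    that Cramer's rule gives for \<open>V1\<close>.  The constants in \<open>u\<close> and \<open>v\<close> make the matrix the
    identity at \<open>t = 1\<close>.\<close>
  define u where "u = [:1 / ((a1 - a2) * (a0 - a2)):] * (f1 * g2 - f2 * g1)"
  define v where "v = [:1 / ((a0 - a1) * (a0 - a2)):] * (f0 * g1 - f1 * g0)"
  have uv_at_1: "poly u 1 = 1 / (a0 - a2)" "poly v 1 = 1 / (a0 - a2)"
    using distinct by (simp_all add: u_def v_def 0 1 2)
  define A :: "'a poly ^ 2 ^ 2" where
    "A = vector [vector [u * f0 - v * f2, [:a0:] * v * f2 - [:a2:] * u * f0],
                 vector [u * g0 - v * g2, [:a0:] * v * g2 - [:a2:] * u * g0]]"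
  have id: "matrix_at_1 A = mat 1"
    using distinct by (simp add: A_def matrix2_simps uv_at_1 0 2 diff_divide_distrib[symmetric])
  then have tangent: "tangent_at_1 (generic_matrix A) (matrix_deriv_at_1 A)"
    unfolding tangent_at_1_def
    by (intro exI[of _ A] exI[of _ 1] exI[of _ 0]) (simp add: vec_eq_iff mat_def)
  have act: "pgl2_act (abs_pgl2 (generic_matrix A)) (affine_point (const_fract z)) =
      abs_pline (vector [to_fract f, to_fract g])"
    if "([:z:] - [:a2:]) * u * (f0 * g - f * g0) + ([:a0:] - [:z:]) * v * (f2 * g - f * g2) = 0"
      and g: "poly g 1 = 1" for z f g
  proof -
    have "bracket (generic_matrix A *v vector [const_fract z, 1]) (vector [to_fract f, to_fract g])
      = to_fract (([:z:] - [:a2:]) * u * (f0 * g - f * g0) + ([:a0:] - [:z:]) * v * (f2 * g - f * g2))"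
      by (simp only: bracket_def matrix2_simps A_def vector_2 nth_map_matrix const_fract_def
          to_fract_add to_fract_mult to_fract_diff)
        (simp add: algebra_simps del: mult_pCons_left mult_pCons_right)
    then have "bracket (generic_matrix A *v vector [const_fract z, 1])
        (vector [to_fract f, to_fract g]) = 0"
      by (simp only: that(1) to_fract_0)
    moreover have "vector [to_fract f, to_fract g] \<noteq> (0 :: 'a poly fract ^ 2)"
      using g by (auto simp: vec_eq_iff forall_2)
    ultimately show ?thesis
      using tangent_at_1_invertible[OF tangent]
      by (simp add: affine_point.abs_eq pgl2_act_abs vector_1_nonzero abs_pline_eq_iff
          invertible_mult_nonzero)
  qed
  let ?e = "[:1 / (a0 - a2):]"
  have u: "([:a1:] - [:a2:]) * u = ?e * (f1 * g2 - f2 * g1)"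
    using distinct by (simp add: u_def)
  have v: "([:a0:] - [:a1:]) * v = ?e * (f0 * g1 - f1 * g0)"
    using distinct by (simp add: v_def)
  have "pgl2_act (abs_pgl2 (generic_matrix A)) (affine_point (const_fract a0)) = q0"
    unfolding 0(1) using 0 by (intro act) simp_all
  moreover have "pgl2_act (abs_pgl2 (generic_matrix A)) (affine_point (const_fract a1)) = q1"
    unfolding 1(1)
  proof (rule act)
    show "([:a1:] - [:a2:]) * u * (f0 * g1 - f1 * g0) +
        ([:a0:] - [:a1:]) * v * (f2 * g1 - f1 * g2) = 0"
      unfolding u v by (simp add: algebra_simps del: mult_pCons_left mult_pCons_right)
  qed (rule 1)
  moreover have "pgl2_act (abs_pgl2 (generic_matrix A)) (affine_point (const_fract a2)) = q2"
    unfolding 2(1) using 2 by (intro act) simp_all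
  ultimately show thesis using that tangent by blast
qed

section \<open>The development over the parameter line\<close>

lemma edge_matrix_const:
  "edge_matrix (const_fract a) (const_fract b) = map_matrix const_fract (edge_matrix a b)"
  by (simp add: edge_matrix_def vec_eq_iff forall_2 const_fract_divide const_fract_diff
      const_fract_1 const_fract_mult const_fract_minus)

lemma parameter_minus_1: "parameter - 1 = to_fract [:-1, 1:]"
  by (simp add: parameter_def one_pCons flip: to_fract_1 to_fract_diff)

lemma tangent_at_1_dilation:
  "tangent_at_1 (dilation (const_fract w * (parameter - 1)) (const_fract a) (const_fract b))
    (map_matrix ((*) w) (edge_matrix a b))"
proof -
  let ?A = "mat 1 + map_matrix (\<lambda>e. smult (w * e) [:-1, 1:]) (edge_matrix a b)"
  have 1: "matrix_at_1 ?A = mat 1"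
    by (simp add: vec_eq_iff mat_def)
  have 2: "generic_matrix ?A = map_matrix ((*) 1)
      (dilation (const_fract w * (parameter - 1)) (const_fract a) (const_fract b))"
    unfolding dilation_def edge_matrix_const parameter_minus_1
    by (simp add: vec_eq_iff mat_def to_fract_smult const_fract_mult del: smult_pCons)
  have 3: "matrix_deriv_at_1 ?A = map_matrix ((*) w) (edge_matrix a b) + mat 0"
    by (simp add: vec_eq_iff mat_def pderiv_add pderiv_pCons)
  show ?thesis unfolding tangent_at_1_def using 1 2 3 by (metis zero_neq_one)
qed

text \<open>Velocities at the identity add under multiplication, hence the sum over the edges in the formula
  for the infinitesimal monodromy.\<close>

lemma tangent_at_1_development:
  fixes H :: "int \<Rightarrow> 'a::field poly fract ^ 2 ^ 2"
  assumes "H 1 = mat 1" and "\<And>i. H (i + 1) = H i ** S i" and "\<And>i. tangent_at_1 (S i) (X i)"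
  shows "tangent_at_1 (H (int k + 1)) (\<Sum>i = 1..int k. X i)"
proof (induction k)
  case 0 show ?case using assms(1) tangent_at_1_id by simp
next
  case (Suc k)
  have "{1..int (Suc k)} = insert (int k + 1) {1..int k}" by auto
  then have "(\<Sum>i = 1..int (Suc k). X i) = (\<Sum>i = 1..int k. X i) + X (int k + 1)"
    by (simp add: add.commute)
  then show ?case
    using tangent_at_1_mult[OF Suc assms(3)[of "int k + 1"]] assms(2)[of "int k + 1"]
    by (simp add: add.commute)
qed

text \<open>Every frame of the development is the identity at \<open>t = 1\<close>, on both sides of index 1, so the
  developed polygon specialises to the reference polygon.\<close>

lemma development_congruent_to_id:
  fixes H :: "int \<Rightarrow> 'a::field poly fract ^ 2 ^ 2"
  assumes "H 1 = mat 1" and step: "\<And>i. H (i + 1) = H i ** S i"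
    and tangent: "\<And>i. tangent_at_1 (S i) (X i)"
  shows "\<exists>Y. tangent_at_1 (H i) Y"
proof (induction i rule: int_induct[of _ 1])
  case base show ?case using assms(1) tangent_at_1_id by auto
next
  case (step1 i) then show ?case using tangent_at_1_mult[OF _ tangent] step by metis
next
  case (step2 i)
  then obtain Y where Y: "tangent_at_1 (H i) Y" by blast
  have "invertible (S (i - 1))" using tangent by (rule tangent_at_1_invertible)
  then obtain T where T: "S (i - 1) ** T = mat 1" by (auto simp: invertible_def)
  have "H (i - 1) ** S (i - 1) ** T = H i ** T" using step[of "i - 1"] by simp
  then have "H (i - 1) = H i ** T" by (simp add: T matrix_mul_assoc[symmetric])
  then show ?case using tangent_at_1_mult[OF Y tangent_at_1_inverse[OF tangent T]] by metis
qed

section \<open>The scaling symmetry\<close>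

text \<open>The logarithmic derivative at \<open>t = 1\<close> of the \<open>i\<close>-th cross-ratio coordinate under the scaling
  symmetry.\<close>

definition log_speed :: "(int \<Rightarrow> 'a::field) \<Rightarrow> int \<Rightarrow> 'a" where
  "log_speed \<alpha> i = (\<alpha> i - 1) * \<alpha> 1 / ((\<alpha> 1 - 1) * \<alpha> i)"

text \<open>The scaling symmetry multiplies each coordinate by a function that is affine in \<open>t\<close> and equals 1
  at \<open>t = 1\<close>; this factor is the nontrivial eigenvalue of the dilation that realises it.\<close>

lemma scaled_coord_eq:
  assumes "\<alpha> 1 \<noteq> 1" "\<alpha> i \<noteq> 0"
  shows "scaled_coord (\<lambda>i. affine_point (x i)) \<alpha> i =
    (1 + const_fract (log_speed \<alpha> i) * (parameter - 1)) *
    cross_ratio_coord (\<lambda>i. affine_point (const_fract (x i))) i"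
proof -
  let ?\<kappa> = "scaling_weight \<alpha> i"
  have "?\<kappa> * (\<alpha> 1 - 1) = \<alpha> i - 1"
    using assms by (simp add: scaling_weight_def)
  then have \<kappa>: "?\<kappa> * \<alpha> 1 - ?\<kappa> = \<alpha> i - 1" by (simp add: algebra_simps)
  have w: "log_speed \<alpha> i * \<alpha> i = ?\<kappa> * \<alpha> 1"
    using assms by (simp add: log_speed_def scaling_weight_def)
  have nz: "const_fract (\<alpha> i) \<noteq> 0"
    using assms by (simp add: const_fract_0[symmetric] const_fract_eq_iff)
  have "const_fract (?\<kappa> * \<alpha> 1 - ?\<kappa>) = const_fract (\<alpha> i - 1)"
    using \<kappa> by simp
  then have "scaled_curvature \<alpha> i = const_fract (\<alpha> i) + const_fract (?\<kappa> * \<alpha> 1) * (parameter - 1)"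
    by (simp add: scaled_curvature_def const_fract_mult const_fract_diff const_fract_1
        algebra_simps)
  also have "\<dots> = const_fract (\<alpha> i) * (1 + const_fract (log_speed \<alpha> i) * (parameter - 1))"
    unfolding w[symmetric] by (simp add: const_fract_mult algebra_simps)
  finally show ?thesis
    using nz by (simp add: scaled_coord_def cross_ratio_coord_const)
qed

lemma one_plus_small_nonzero: "1 + const_fract w * (parameter - 1) \<noteq> 0"
proof -
  have "poly (1 + smult w [:-1, 1:]) 1 = 1" by simp
  then have "1 + smult w [:-1, 1:] \<noteq> 0" by (metis poly_0 zero_neq_one)
  then have "to_fract (1 + smult w [:-1, 1:]) \<noteq> 0" unfolding to_fract_eq_0_iff .
  then show ?thesis
    by (simp only: parameter_minus_1 to_fract_add to_fract_1 to_fract_smult simp_thms)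
qed

lemma closed_ngon_affineD:
  assumes "closed_ngon n (\<lambda>i. affine_point (x i))"
  shows "x (i + int n) = x i" "x i \<noteq> x (i + 1)" "x i \<noteq> x (i + 2)"
  using assms by (simp_all add: closed_ngon_def twisted_ngon_def pgl2_act_id affine_point_eq_iff)

text \<open>The development with the dilations \<open>S i\<close> is one lift, with monodromy \<open>H (int n + 1)\<close>.  Any other
  lift is its image under a transformation \<open>G\<close> that is the identity at \<open>t = 1\<close>, so its monodromy is
  conjugated by \<open>G\<close>, which does not affect the velocity at the identity.\<close>

lemma infinitesimal_monodromy_formula:
  fixes x \<alpha> :: "int \<Rightarrow> 'a::field"
  assumes closed: "closed_ngon n (\<lambda>i. affine_point (x i))"
    and curvature: "discrete_curvature n \<alpha>"
  shows "is_infinitesimal_monodromy n (\<lambda>i. affine_point (x i))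
    (scaled_coord (\<lambda>i. affine_point (x i)) \<alpha>)
    (abs_lie_pgl2 (\<Sum>i = 1..int n. map_matrix ((*) (log_speed \<alpha> i)) (edge_matrix (x i) (x (i + 1)))))"
    (is "is_infinitesimal_monodromy n ?p ?c (abs_lie_pgl2 ?\<xi>)")
proof -
  define y where "y i = const_fract (x i)" for i
  define s where "s i = const_fract (log_speed \<alpha> i) * (parameter - 1)" for i
  define S where "S i = dilation (s i) (y i) (y (i + 1))" for i
  define X where "X i = map_matrix ((*) (log_speed \<alpha> i)) (edge_matrix (x i) (x (i + 1)))" for i
  have x: "x (i + int n) = x i" "x i \<noteq> x (i + 1)" "x i \<noteq> x (i + 2)" for i
    using closed_ngon_affineD[OF closed] by auto
  have \<alpha>: "\<alpha> (i + int n) = \<alpha> i" "\<alpha> i \<noteq> 0" "\<alpha> i \<noteq> 1" for i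
    using curvature by (auto simp: discrete_curvature_def)
  have y_distinct: "y i \<noteq> y (i + 1)" "y i \<noteq> y (i + 2)" for i
    using x(2,3) by (simp_all add: y_def const_fract_eq_iff)
  have s_nz: "1 + s i \<noteq> 0" for i
    unfolding s_def by (rule one_plus_small_nonzero)
  have y_per: "y (i + int n) = y i" for i by (simp add: y_def x)
  have S_per: "S (i + int n) = S i" for i
    using y_per[of "i + 1"] by (simp add: S_def y_per s_def log_speed_def \<alpha> algebra_simps)
  have S_tangent: "tangent_at_1 (S i) (X i)" for i
    unfolding S_def X_def s_def y_def by (rule tangent_at_1_dilation)
  have S_inv: "invertible (S i)" for i
    using S_tangent by (rule tangent_at_1_invertible)
  have coord: "?c i = (1 + s i) * cross_ratio_coord (\<lambda>i. affine_point (y i)) i" for i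
    unfolding s_def y_def by (rule scaled_coord_eq) (use \<alpha> in auto)
  obtain H where H1: "H 1 = mat 1" and H_step: "\<And>i. H (i + 1) = H i ** S i"
    and H_inv: "\<And>i. invertible (H i)"
    using exists_development[of S] S_inv by blast
  have H_per: "H (i + int n) = H (int n + 1) ** H i" for i
    using H1 H_step S_inv S_per by (rule development_periodic)
  have H_tangent: "tangent_at_1 (H (int n + 1)) ?\<xi>"
    using tangent_at_1_development[OF H1 H_step S_tangent, of n] by (simp add: X_def)
  interpret standard: developed_polygon y s H
    using y_distinct s_nz H_inv H_step by unfold_locales (auto simp: S_def)
  have "lift_of_deformation n ?p pgl2_id ?c standard.vertex (abs_pgl2 (H (int n + 1)))"
    unfolding lift_of_deformation_def twisted_ngon_def
  proof (intro conjI allI)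
    fix i
    show "standard.vertex (i + int n) = pgl2_act (abs_pgl2 (H (int n + 1))) (standard.vertex i)"
      by (simp add: standard.vertex_def H_per y_per pgl2_act_mult H_inv)
    show "standard.vertex i \<noteq> standard.vertex (i + 1)" "standard.vertex i \<noteq> standard.vertex (i + 2)"
      by (rule standard.vertex_distinct)+
    show "standard.vertex (i + 1) \<noteq> standard.vertex (i + 2)"
      using standard.vertex_distinct(1)[of "i + 1"] by (simp add: add.assoc)
    show "point_at_1 (standard.vertex i) (?p i)"
      using development_congruent_to_id[OF H1 H_step S_tangent] point_at_1_tangent
      unfolding standard.vertex_def y_def by blast
    show "pgl2_at_1 (abs_pgl2 (H (int n + 1))) pgl2_id"
      using H_tangent by (rule pgl2_at_1_tangent)
    show "cross_ratio_coord standard.vertex i = ?c i"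
      by (simp add: standard.cross_ratio_coord_vertex coord)
  qed
  moreover have "velocity_at_1 M \<eta> \<longleftrightarrow> \<eta> = abs_lie_pgl2 ?\<xi>"
    if lift: "lift_of_deformation n ?p pgl2_id ?c q M" for q M \<eta>
  proof -
    have q_shift: "q (i + int n) = pgl2_act M (q i)"
      and q_distinct: "q i \<noteq> q (i + 1)" "q i \<noteq> q (i + 2)"
      and q_at_1: "point_at_1 (q i) (?p i)" and q_coord: "cross_ratio_coord q i = ?c i" for i
      using lift by (auto simp: lift_of_deformation_def twisted_ngon_def)
    have x012: "x 0 \<noteq> x 1" "x 0 \<noteq> x 2" "x 1 \<noteq> x 2"
      using x(2)[of 0] x(3)[of 0] x(2)[of 1] by simp_all
    obtain G Y where G: "tangent_at_1 G Y" and act_G: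
      "pgl2_act (abs_pgl2 G) (affine_point (y 0)) = q 0"
      "pgl2_act (abs_pgl2 G) (affine_point (y 1)) = q 1"
      "pgl2_act (abs_pgl2 G) (affine_point (y 2)) = q 2"
      using exists_frame_at_1[OF x012 q_at_1 q_at_1 q_at_1] unfolding y_def by blast
    have G_inv: "invertible G" using G by (rule tangent_at_1_invertible)
    interpret moved: developed_polygon y s "\<lambda>i. G ** H i"
      using y_distinct s_nz H_inv G_inv H_step
      by unfold_locales (auto simp: S_def invertible_mult matrix_mul_assoc)
    have "q 0 = moved.vertex 0" "q 1 = moved.vertex 1" "q 2 = moved.vertex 2"
      using act_G moved.frame_previous[of 1] moved.frame_next[of 1] moved.vertex_def[of 1]
      by (simp_all add: H1)
    then have q_vertex: "q (int k) = moved.vertex (int k)" for k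
      by (intro moved.vertex_unique)
        (simp_all add: q_distinct q_coord coord moved.cross_ratio_coord_vertex)
    let ?H = "H (int n + 1)"
    \<comment> \<open>the frame \<open>G ** ?H\<close>, of index \<open>int n + 1\<close>, carries the vertices 0, 1, 2 to those one period
      later, which is what \<open>N ** G\<close> does by definition of the monodromy\<close>
    have "q (int n) = pgl2_act (abs_pgl2 (G ** ?H)) (affine_point (y 0))"
      "q (int n + 1) = pgl2_act (abs_pgl2 (G ** ?H)) (affine_point (y 1))"
      "q (int n + 2) = pgl2_act (abs_pgl2 (G ** ?H)) (affine_point (y 2))"
      using q_vertex[of n] q_vertex[of "n + 1"] q_vertex[of "n + 2"]
        moved.frame_previous[of "int n + 1"] moved.frame_next[of "int n + 1"]
        moved.vertex_def[of "int n + 1"] y_per[of 0] y_per[of 1] y_per[of 2]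
      by (simp_all add: algebra_simps)
    moreover obtain N where N: "invertible N" "M = abs_pgl2 N" by (rule pgl2_cases)
    ultimately have agree: "pgl2_act (abs_pgl2 (N ** G)) (affine_point z) =
        pgl2_act (abs_pgl2 (G ** ?H)) (affine_point z)" if "z \<in> {y 0, y 1, y 2}" for z
      using that q_shift[of 0] q_shift[of 1] q_shift[of 2]
      by (auto simp: pgl2_act_mult[OF N(1) G_inv] act_G add.commute)
    have "abs_pgl2 (N ** G) = abs_pgl2 (G ** ?H)"
      by (rule pgl2_eqI_three_points[OF _ _ _ _ _ agree])
        (use y_distinct[of 0] y_distinct(1)[of 1] N G_inv H_inv in \<open>simp_all add: invertible_mult\<close>)
    then obtain c where c: "c \<noteq> 0" "G ** ?H = map_matrix ((*) c) (N ** G)"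
      using N G_inv H_inv by (auto simp: abs_pgl2_eq_iff invertible_mult)
    \<comment> \<open>the monodromy of the lift is the conjugate of the standard one by \<open>G\<close>\<close>
    obtain C where C: "G ** C = mat 1" using G_inv by (auto simp: invertible_def)
    have "G ** ?H ** C = map_matrix ((*) c) (N ** (G ** C))"
      unfolding c(2) by (simp add: matrix2_simps algebra_simps)
    then have conj: "G ** ?H ** C = map_matrix ((*) c) N" by (simp add: C)
    have "tangent_at_1 (G ** ?H ** C) (Y + ?\<xi> + - Y)"
      by (intro tangent_at_1_mult G H_tangent tangent_at_1_inverse[OF G C])
    then have tangent: "tangent_at_1 (G ** ?H ** C) ?\<xi>" by simp
    have "M = abs_pgl2 (G ** ?H ** C)"
      using N abs_pgl2_eq_iff[OF N(1) tangent_at_1_invertible[OF tangent]] c(1) conj by blast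
    then show ?thesis using velocity_at_1_tangent[OF tangent] by simp
  qed
  ultimately show ?thesis
    unfolding is_infinitesimal_monodromy_def by blast
qed

section \<open>Fixed points of the infinitesimal monodromy\<close>

text \<open>In the plane \<open>v\<close> is an eigenvector of \<open>A\<close> when \<open>v\<close> and \<open>A *v v\<close> are linearly dependent.  This
  turns the eigenvector condition into a quadratic form that is linear in \<open>A\<close>.\<close>

lemma is_eigenvector_iff_bracket:
  assumes "v \<noteq> 0"
  shows "is_eigenvector (abs_lie_pgl2 A) v \<longleftrightarrow> bracket v (A *v v) = 0"
proof
  assume "is_eigenvector (abs_lie_pgl2 A) v"
  then show "bracket v (A *v v) = 0"
    by (auto simp: is_eigenvector.abs_eq bracket_def)
next
  assume 0: "bracket v (A *v v) = 0"
  have "\<exists>k. A *v v = k *s v"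
  proof (cases "A *v v = 0")
    case True then show ?thesis by (intro exI[of _ 0]) simp
  next
    case False
    then show ?thesis using 0 proportional_iff_bracket[OF assms False]
      by (auto simp: proportional_def)
  qed
  then show "is_eigenvector (abs_lie_pgl2 A) v"
    using assms by (simp add: is_eigenvector.abs_eq)
qed

lemma bracket_sum_matrix:
  "bracket v (sum A I *v v) = (\<Sum>i\<in>I. bracket v (A i *v v))"
  by (induction I rule: infinite_finite_induct)
    (simp_all add: bracket_def matrix2_simps algebra_simps)

lemma bracket_edge_matrix:
  "bracket (vector [X, Y]) (map_matrix ((*) w) (edge_matrix a b) *v vector [X, Y]) =
    w * ((X - a * Y) * (X - b * Y) / (a - b))"
  by (simp add: bracket_def edge_matrix_def matrix2_simps divide_inverse algebra_simps)

text \<open>Each edge contributes a quadratic form vanishing at its two ends, the fixed points of its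
  dilation; the common factor \<open>\<alpha> 1 / (\<alpha> 1 - 1)\<close> does not change the zeros of the sum.\<close>

lemma is_eigenvector_iff_chi:
  fixes x \<alpha> :: "int \<Rightarrow> 'a::field"
  assumes "\<alpha> 1 \<noteq> 0" "\<alpha> 1 \<noteq> 1" and "(X, Y) \<noteq> (0, 0)"
  shows "is_eigenvector (abs_lie_pgl2
      (\<Sum>i = 1..int n. map_matrix ((*) (log_speed \<alpha> i)) (edge_matrix (x i) (x (i + 1)))))
    (vector [X, Y]) \<longleftrightarrow> chi n x \<alpha> X Y = 0"
proof -
  have "vector [X, Y] \<noteq> (0 :: 'a ^ 2)"
    using assms by (auto simp: vec_eq_iff forall_2)
  moreover have "bracket (vector [X, Y])
      ((\<Sum>i = 1..int n. map_matrix ((*) (log_speed \<alpha> i)) (edge_matrix (x i) (x (i + 1))))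
        *v vector [X, Y]) = \<alpha> 1 / (\<alpha> 1 - 1) * chi n x \<alpha> X Y"
    by (simp add: bracket_sum_matrix bracket_edge_matrix chi_def log_speed_def sum_distrib_left
        ac_simps)
  ultimately show ?thesis using assms by (simp add: is_eigenvector_iff_bracket)
qed

theorem proposition5p6:
  fixes n :: nat and x \<alpha> :: "int \<Rightarrow> 'a::field"
  assumes "n \<ge> 3"
    and "closed_ngon n (\<lambda>i. affine_point (x i))"
    and "discrete_curvature n \<alpha>"
  shows "let p = (\<lambda>i. affine_point (x i));
             \<xi> = abs_lie_pgl2
               (\<Sum>i = 1..int n. map_matrix ((*) ((\<alpha> i - 1) * \<alpha> 1 / ((\<alpha> 1 - 1) * \<alpha> i)))
                                  (edge_matrix (x i) (x (i + 1))))
         in is_infinitesimal_monodromy n p (scaled_coord p \<alpha>) \<xi> \<and>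
            (\<forall>X Y. (X, Y) \<noteq> (0, 0) \<longrightarrow>
               (is_eigenvector \<xi> (vector [X, Y]) \<longleftrightarrow> chi n x \<alpha> X Y = 0))"
proof -
  have \<alpha>: "\<alpha> 1 \<noteq> 0" "\<alpha> 1 \<noteq> 1"
    using assms(3) by (simp_all add: discrete_curvature_def)
  show ?thesis
    unfolding Let_def log_speed_def[symmetric]
    using infinitesimal_monodromy_formula[OF assms(2,3)] is_eigenvector_iff_chi[of \<alpha>, OF \<alpha>]
    by blast
qed

end
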